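(* Let $d\ge 2$, $m\ge 2$ and $k$ be integers with $d\ge 2k$ and $m\le d+k$. Let $\mathbf p=\{p_1,\dots,p_m\}$ be nonnegative integers with $p_1\le p_2\le\dots\le p_m$, and let $n$ be a nonnegative integer with $\binom{n+d}{d}=\sum_{q=1}^m\binom{p_q+d}{d}$. Except in the Lagrange case (all $p_q=0$), the Hermite interpolation scheme $\mathbf p$ of type total degree in $\mathbb R^d$ is singular.
   Context: $\Pi_n^d$ denotes the space of real polynomials in $d$ variables of total degree at most $n$. Let $\mathbf p=\{p_1,\dots,p_m\}$ be nonnegative integers and let $n$ satisfy $\binom{n+d}{d}=\sum_{q=1}^m\binom{p_q+d}{d}$. For a set $\mathcal X=\{X_1,\dots,X_m\}$ of pairwise distinct points in $\mathbb R^d$, the Hermite interpolation problem of type total degree $(\mathbf p,\mathcal X)$ is: find $f\in\Pi_n^d$ with $\frac{\partial^{|\alpha|}f}{\partial x_1^{\alpha_1}\cdots\partial x_d^{\alpha_d}}(X_q)=c_{q,\alpha}$ for all $1\le q\le m$ and all $\alpha\in\mathbb N_0^d$ with $0\le|\alpha|=\alpha_1+\dots+\alpha_d\le p_q$. The problem $(\mathbf p,\mathcal X)$ is regular if it has a unique solution for every choice of real values $c_{q,\alpha}$, and singular otherwise. The scheme $\mathbf p$ is singular if $(\mathbf p,\mathcal X)$ is singular for all sets $\mathcal X$ of $m$ pairwise distinct points. *)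

theory Defs
  imports "HOL-Analysis.Analysis"
begin

definition mdeg :: "('n::finite \<Rightarrow> nat) \<Rightarrow> nat"
  where "mdeg \<alpha> = (\<Sum>i\<in>UNIV. \<alpha> i)"

lemma finite_mdeg_le: "finite {\<alpha> :: 'n::finite \<Rightarrow> nat. mdeg \<alpha> \<le> n}"
proof (rule finite_subset)
  show "{\<alpha> :: 'n \<Rightarrow> nat. mdeg \<alpha> \<le> n} \<subseteq> (\<Pi>\<^sub>E i\<in>UNIV. {..n})"
  proof
    fix \<alpha> :: "'n \<Rightarrow> nat"
    assume "\<alpha> \<in> {\<alpha>. mdeg \<alpha> \<le> n}"
    moreover have "\<alpha> i \<le> mdeg \<alpha>" for i
      unfolding mdeg_def by (rule member_le_sum) simp_all
    ultimately have "\<alpha> i \<le> n" for i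
      using order_trans by blast
    then show "\<alpha> \<in> (\<Pi>\<^sub>E i\<in>UNIV. {..n})"
      by (simp add: PiE_UNIV_domain)
  qed
  show "finite (\<Pi>\<^sub>E i\<in>(UNIV :: 'n set). {..n})"
    by (rule finite_PiE) simp_all
qed

text \<open>Real polynomials of total degree at most \<open>n\<close>, as functions on \<open>real ^ 'n\<close>; over the
  reals a polynomial is determined by its function.\<close>

definition poly_space :: "nat \<Rightarrow> (real ^ 'n \<Rightarrow> real) set"
  where "poly_space n =
    {f. \<exists>a. f = (\<lambda>x. \<Sum>\<alpha> | mdeg \<alpha> \<le> n. a \<alpha> * (\<Prod>i\<in>UNIV. (x $ i) ^ \<alpha> i))}"

definition partial_deriv :: "'n::finite \<Rightarrow> (real ^ 'n \<Rightarrow> real) \<Rightarrow> real ^ 'n \<Rightarrow> real"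
  where "partial_deriv i f = (\<lambda>x. deriv (\<lambda>t. f (x + t *\<^sub>R axis i 1)) 0)"

text \<open>An index type carries no order, so the coordinates are listed in an arbitrary fixed order.
  The choice affects \<open>mixed_deriv\<close> only through the order of differentiation, which is
  irrelevant for polynomials.\<close>

definition coord_list :: "'n::finite list"
  where "coord_list = (SOME is. distinct is \<and> set is = UNIV)"

lemma coord_list: "distinct (coord_list :: 'n::finite list)" "set (coord_list :: 'n list) = UNIV"
proof -
  have "\<exists>is :: 'n list. distinct is \<and> set is = UNIV"
    using finite_distinct_list[of "UNIV :: 'n set"] by auto
  from someI_ex[OF this]
  show "distinct (coord_list :: 'n list)" "set (coord_list :: 'n list) = UNIV"
    by (simp_all add: coord_list_def)
qed

definition mixed_deriv ::
    "('n::finite \<Rightarrow> nat) \<Rightarrow> (real ^ 'n \<Rightarrow> real) \<Rightarrow> real ^ 'n \<Rightarrow> real"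
  where "mixed_deriv \<alpha> f = foldr (\<lambda>i. partial_deriv i ^^ \<alpha> i) coord_list f"

text \<open>In the following, points, orders and data are indexed by \<open>{1..m}\<close>.\<close>

definition hermite_solution ::
    "nat \<Rightarrow> nat \<Rightarrow> (nat \<Rightarrow> nat) \<Rightarrow> (nat \<Rightarrow> real ^ 'n) \<Rightarrow>
     (nat \<Rightarrow> ('n \<Rightarrow> nat) \<Rightarrow> real) \<Rightarrow> (real ^ 'n \<Rightarrow> real) \<Rightarrow> bool"
  where "hermite_solution n m p X c f \<longleftrightarrow>
    f \<in> poly_space n \<and>
    (\<forall>q\<in>{1..m}. \<forall>\<alpha>. mdeg \<alpha> \<le> p q \<longrightarrow> mixed_deriv \<alpha> f (X q) = c q \<alpha>)"

definition hermite_regular ::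
    "nat \<Rightarrow> nat \<Rightarrow> (nat \<Rightarrow> nat) \<Rightarrow> (nat \<Rightarrow> real ^ 'n) \<Rightarrow> bool"
  where "hermite_regular n m p X \<longleftrightarrow> (\<forall>c. \<exists>!f. hermite_solution n m p X c f)"

definition scheme_singular :: "'n::finite itself \<Rightarrow> nat \<Rightarrow> nat \<Rightarrow> (nat \<Rightarrow> nat) \<Rightarrow> bool"
  where "scheme_singular _ n m p \<longleftrightarrow>
    (\<forall>X :: nat \<Rightarrow> real ^ 'n. inj_on X {1..m} \<longrightarrow> \<not> hermite_regular n m p X)"

end

theory Submission
  imports Defs
begin

text \<open>
  A regular problem forces two inequalities that pull in opposite directions.

  Restricted to the line through two nodes \<open>X q\<close> and \<open>X r\<close>, a polynomial of degree at most \<open>n\<close>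
  becomes a univariate polynomial of degree at most \<open>n\<close>, while the data prescribe its
  derivatives up to order \<open>p q\<close> at one point and up to order \<open>p r\<close> at another. If \<open>p q + p r \<ge> n\<close>,
  these univariate conditions are overdetermined and some data admit no solution. So existence
  gives \<open>p q + p r + 1 \<le> n\<close> (\<open>regular_pair_bound\<close>): the orders are small.

  In dimension \<open>d\<close>, every \<open>d\<close> points lie on a hyperplane, so a product of \<open>n\<close> affine forms can be
  made to vanish at any \<open>n * d\<close> incidences between nodes and factors. If the node \<open>X q\<close> lies on
  at least \<open>p q + 1\<close> of the hyperplanes, for every \<open>q\<close>, the product is a nonzero
  solution of the homogeneous problem. So uniqueness gives \<open>n * d < (\<Sum>q. p q + 1)\<close>
  (\<open>regular_total_bound\<close>): the orders are large on average.

  Pairs of the numbers \<open>p q + 1\<close> add up to at most \<open>n + 1\<close>, so their sum over all nodes is at most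
  \<open>m * (n + 1) / 2\<close>. The hypotheses on \<open>k\<close> amount to \<open>m \<le> 3 * d / 2\<close>, and
  \<open>n * d < 3 * d * (n + 1) / 4\<close> leaves only \<open>n < 3\<close>. Outside the Lagrange case \<open>n \<ge> 2\<close>, and for
  \<open>n = 2\<close> at most one order is positive, which is again too few (\<open>incompatible_bounds\<close>).

  Both parts use the expansion of a polynomial in powers of \<open>x - X\<close>, whose coefficients are
  the derivatives at \<open>X\<close> up to nonzero factors; thus no product rule or chain rule for
  mixed derivatives is needed.
\<close>

section \<open>Polynomials in powers of \<open>x - X\<close>\<close>

definition shifted_monomial :: "real ^ 'n \<Rightarrow> ('n \<Rightarrow> nat) \<Rightarrow> real ^ 'n \<Rightarrow> real"
  where "shifted_monomial X \<alpha> x = (\<Prod>i\<in>UNIV. (x $ i - X $ i) ^ \<alpha> i)"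

text \<open>These are the polynomials of degree at most \<open>n\<close> that vanish to order \<open>r\<close> at \<open>X\<close>. Keeping track
  of both bounds at once lets one induction over the factors of a product of affine forms
  control its degree and its order of vanishing.\<close>

definition vanishing_space :: "real ^ 'n \<Rightarrow> nat \<Rightarrow> nat \<Rightarrow> (real ^ 'n \<Rightarrow> real) set"
  where "vanishing_space X r n =
    {f. \<exists>a. f = (\<lambda>x. \<Sum>\<alpha> | r \<le> mdeg \<alpha> \<and> mdeg \<alpha> \<le> n. a \<alpha> * shifted_monomial X \<alpha> x)}"

lemma finite_mdeg_range: "finite {\<alpha> :: 'n::finite \<Rightarrow> nat. r \<le> mdeg \<alpha> \<and> mdeg \<alpha> \<le> n}"
  by (rule finite_subset[OF _ finite_mdeg_le[of n]]) auto

lemma mdeg_upd_Suc: "mdeg (\<alpha>(i := Suc (\<alpha> i))) = Suc (mdeg \<alpha>)"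
proof -
  have "(\<Sum>j\<in>UNIV - {i}. (\<alpha>(i := Suc (\<alpha> i))) j) = (\<Sum>j\<in>UNIV - {i}. \<alpha> j)"
    by (rule sum.cong) auto
  then show ?thesis
    unfolding mdeg_def by (simp add: sum.remove[of UNIV i])
qed

lemma shifted_monomial_upd:
  "shifted_monomial X (\<alpha>(i := k)) x = (x $ i - X $ i) ^ k * (\<Prod>j\<in>UNIV - {i}. (x $ j - X $ j) ^ \<alpha> j)"
proof -
  have "(\<Prod>j\<in>UNIV - {i}. (x $ j - X $ j) ^ (\<alpha>(i := k)) j) = (\<Prod>j\<in>UNIV - {i}. (x $ j - X $ j) ^ \<alpha> j)"
    by (rule prod.cong) auto
  then show ?thesis
    unfolding shifted_monomial_def by (simp add: prod.remove[of UNIV i])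
qed

lemma shifted_monomial_upd_Suc:
  "shifted_monomial X (\<alpha>(i := Suc (\<alpha> i))) x = (x $ i - X $ i) * shifted_monomial X \<alpha> x"
  using shifted_monomial_upd[of X \<alpha> i "\<alpha> i" x] by (simp add: shifted_monomial_upd)

lemma shifted_monomial_center: "shifted_monomial X \<alpha> X = (if \<alpha> = (\<lambda>_. 0) then 1 else 0)"
  by (auto simp: shifted_monomial_def fun_eq_iff)

lemma shifted_monomial_line:
  "shifted_monomial X \<alpha> (X + t *\<^sub>R v) = (\<Prod>i\<in>UNIV. (v $ i) ^ \<alpha> i) * t ^ mdeg \<alpha>"
  by (simp add: shifted_monomial_def mdeg_def power_mult_distrib prod.distrib power_sum mult.commute)

lemma vanishing_space_zero: "(\<lambda>x. 0) \<in> vanishing_space X r n"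
  unfolding vanishing_space_def by (rule CollectI, rule exI[of _ "\<lambda>_. 0"]) simp

lemma vanishing_space_add:
  assumes "f \<in> vanishing_space X r n" "g \<in> vanishing_space X r n"
  shows "(\<lambda>x. f x + g x) \<in> vanishing_space X r n"
proof -
  obtain a b where
    "f = (\<lambda>x. \<Sum>\<alpha> | r \<le> mdeg \<alpha> \<and> mdeg \<alpha> \<le> n. a \<alpha> * shifted_monomial X \<alpha> x)"
    "g = (\<lambda>x. \<Sum>\<alpha> | r \<le> mdeg \<alpha> \<and> mdeg \<alpha> \<le> n. b \<alpha> * shifted_monomial X \<alpha> x)"
    using assms unfolding vanishing_space_def by auto
  then show ?thesis
    unfolding vanishing_space_def
    by (intro CollectI exI[of _ "\<lambda>\<alpha>. a \<alpha> + b \<alpha>"]) (simp add: sum.distrib distrib_right)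
qed

lemma vanishing_space_scale:
  assumes "f \<in> vanishing_space X r n"
  shows "(\<lambda>x. c * f x) \<in> vanishing_space X r n"
proof -
  obtain a where
    "f = (\<lambda>x. \<Sum>\<alpha> | r \<le> mdeg \<alpha> \<and> mdeg \<alpha> \<le> n. a \<alpha> * shifted_monomial X \<alpha> x)"
    using assms unfolding vanishing_space_def by auto
  then show ?thesis
    unfolding vanishing_space_def
    by (intro CollectI exI[of _ "\<lambda>\<alpha>. c * a \<alpha>"]) (simp add: sum_distrib_left mult.assoc)
qed

lemma vanishing_space_sum:
  assumes "\<And>s. s \<in> A \<Longrightarrow> f s \<in> vanishing_space X r n"
  shows "(\<lambda>x. \<Sum>s\<in>A. f s x) \<in> vanishing_space X r n"
  using assms
  by (induction A rule: infinite_finite_induct) (auto intro: vanishing_space_zero vanishing_space_add)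

lemma shifted_monomial_in_vanishing_space:
  assumes "r \<le> mdeg \<alpha>" "mdeg \<alpha> \<le> n"
  shows "shifted_monomial X \<alpha> \<in> vanishing_space X r n"
proof -
  have "(\<Sum>\<beta> | r \<le> mdeg \<beta> \<and> mdeg \<beta> \<le> n. of_bool (\<beta> = \<alpha>) * shifted_monomial X \<beta> x)
      = (\<Sum>\<beta> | r \<le> mdeg \<beta> \<and> mdeg \<beta> \<le> n. if \<beta> = \<alpha> then shifted_monomial X \<beta> x else 0)" for x
    by (rule sum.cong) auto
  then show ?thesis
    unfolding vanishing_space_def using assms
    by (intro CollectI exI[of _ "\<lambda>\<beta>. of_bool (\<beta> = \<alpha>)"]) (simp add: finite_mdeg_range sum.delta)
qed

lemma vanishing_space_mono:
  assumes "f \<in> vanishing_space X r n" "r' \<le> r" "n \<le> n'"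
  shows "f \<in> vanishing_space X r' n'"
proof -
  obtain a where
    "f = (\<lambda>x. \<Sum>\<alpha> | r \<le> mdeg \<alpha> \<and> mdeg \<alpha> \<le> n. a \<alpha> * shifted_monomial X \<alpha> x)"
    using assms unfolding vanishing_space_def by auto
  then show ?thesis
    using assms(2,3)
    by (auto intro!: vanishing_space_sum vanishing_space_scale shifted_monomial_in_vanishing_space)
qed

lemma vanishing_space_mult_coordinate:
  assumes "f \<in> vanishing_space X r n"
  shows "(\<lambda>x. (x $ i - X $ i) * f x) \<in> vanishing_space X (Suc r) (Suc n)"
proof -
  obtain a where
    f: "f = (\<lambda>x. \<Sum>\<alpha> | r \<le> mdeg \<alpha> \<and> mdeg \<alpha> \<le> n. a \<alpha> * shifted_monomial X \<alpha> x)"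
    using assms unfolding vanishing_space_def by auto
  have "(\<lambda>x. (x $ i - X $ i) * f x) =
      (\<lambda>x. \<Sum>\<alpha> | r \<le> mdeg \<alpha> \<and> mdeg \<alpha> \<le> n. a \<alpha> * shifted_monomial X (\<alpha>(i := Suc (\<alpha> i))) x)"
    unfolding f shifted_monomial_upd_Suc by (simp add: sum_distrib_left mult_ac)
  also have "\<dots> \<in> vanishing_space X (Suc r) (Suc n)"
    by (intro vanishing_space_sum vanishing_space_scale shifted_monomial_in_vanishing_space)
      (auto simp: mdeg_upd_Suc)
  finally show ?thesis .
qed

text \<open>An affine form that vanishes at \<open>X\<close> is homogeneous of degree one in \<open>x - X\<close>, hence
  it raises the order of vanishing as well as the degree.\<close>

lemma vanishing_space_mult_affine_through:
  assumes f: "f \<in> vanishing_space X r n" and X: "w \<bullet> X = b"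
  shows "(\<lambda>x. (w \<bullet> x - b) * f x) \<in> vanishing_space X (Suc r) (Suc n)"
proof -
  have "(\<lambda>x. (w \<bullet> x - b) * f x) = (\<lambda>x. \<Sum>i\<in>UNIV. w $ i * ((x $ i - X $ i) * f x))"
    unfolding X[symmetric] inner_diff_right[symmetric]
    by (simp add: inner_vec_def sum_distrib_right mult.assoc)
  then show ?thesis
    by (simp add: vanishing_space_sum vanishing_space_scale vanishing_space_mult_coordinate[OF f])
qed

text \<open>The constant term at \<open>X\<close> of a general affine form preserves the order of vanishing without
  raising it.\<close>

lemma vanishing_space_mult_affine:
  assumes f: "f \<in> vanishing_space X r n"
  shows "(\<lambda>x. (w \<bullet> x - b) * f x) \<in> vanishing_space X r (Suc n)"
proof -
  have "(\<lambda>x. (w \<bullet> x - w \<bullet> X) * f x) \<in> vanishing_space X r (Suc n)"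
    using vanishing_space_mono[OF vanishing_space_mult_affine_through[OF f refl]] by simp
  moreover have "(\<lambda>x. (w \<bullet> X - b) * f x) \<in> vanishing_space X r (Suc n)"
    using vanishing_space_mono[OF vanishing_space_scale[OF f]] by simp
  ultimately show ?thesis
    using vanishing_space_add by (fastforce simp: algebra_simps)
qed

text \<open>A monomial centred at \<open>Y\<close> is a product of affine forms, and multiplication by an affine form
  has been described with respect to any centre \<open>X\<close>. This replaces the multinomial theorem.\<close>

lemma shifted_monomial_recenter: "shifted_monomial Y \<alpha> \<in> vanishing_space X 0 (mdeg \<alpha>)"
proof (induction "mdeg \<alpha>" arbitrary: \<alpha>)
  case 0
  then have "\<alpha> = (\<lambda>_. 0)"
    by (auto simp: mdeg_def)
  then have "shifted_monomial Y \<alpha> = shifted_monomial X \<alpha>"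
    by (simp add: shifted_monomial_def fun_eq_iff)
  then show ?case
    by (simp add: shifted_monomial_in_vanishing_space)
next
  case (Suc k)
  obtain i where i: "\<alpha> i > 0"
    using Suc(2) by (cases "\<forall>i. \<alpha> i = 0") (auto simp: mdeg_def)
  define \<beta> where "\<beta> = \<alpha>(i := \<alpha> i - 1)"
  have \<alpha>: "\<alpha> = \<beta>(i := Suc (\<beta> i))"
    using i by (auto simp: \<beta>_def)
  then have k: "k = mdeg \<beta>"
    using Suc(2) mdeg_upd_Suc[of \<beta> i] by simp
  have "shifted_monomial Y \<alpha> = (\<lambda>x. (axis i 1 \<bullet> x - Y $ i) * shifted_monomial Y \<beta> x)"
    unfolding \<alpha> by (simp add: inner_axis' fun_eq_iff shifted_monomial_upd_Suc)
  also have "\<dots> \<in> vanishing_space X 0 (Suc (mdeg \<beta>))"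
    using vanishing_space_mult_affine Suc(1)[OF k] k by blast
  finally show ?case
    using Suc(2) k by simp
qed

lemma vanishing_space_recenter: "vanishing_space Y 0 n \<subseteq> vanishing_space X 0 n"
proof
  fix f
  assume "f \<in> vanishing_space Y 0 n"
  then obtain a where f: "f = (\<lambda>x. \<Sum>\<alpha> | mdeg \<alpha> \<le> n. a \<alpha> * shifted_monomial Y \<alpha> x)"
    unfolding vanishing_space_def by auto
  show "f \<in> vanishing_space X 0 n"
    unfolding f
    by (intro vanishing_space_sum vanishing_space_scale
        vanishing_space_mono[OF shifted_monomial_recenter]) auto
qed

lemma poly_space_eq_vanishing_space: "poly_space n = vanishing_space X 0 n"
proof -
  have "poly_space n = vanishing_space (0 :: real ^ 'a) 0 n"
    by (simp add: poly_space_def vanishing_space_def shifted_monomial_def)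
  then show ?thesis
    using vanishing_space_recenter by blast
qed

section \<open>Partial derivatives as Taylor coefficients\<close>

text \<open>This is the falling factorial \<open>e (e - 1) \<dots> (e - k + 1)\<close>, the factor in the \<open>k\<close>-th derivative
  of a power with exponent \<open>e\<close>. The subtraction on natural numbers is harmless: once it truncates,
  the factor with \<open>j = e\<close> has already made the product vanish.\<close>

definition deriv_factor :: "nat \<Rightarrow> nat \<Rightarrow> real"
  where "deriv_factor e k = (\<Prod>j<k. real (e - j))"

lemma deriv_factor_self: "deriv_factor e e \<noteq> 0"
  by (simp add: deriv_factor_def)

lemma deriv_factor_eq_0: "e < k \<Longrightarrow> deriv_factor e k = 0"
  by (auto simp: deriv_factor_def)

text \<open>The exponents \<open>e s\<close> are separated from the summation index \<open>s\<close> because differentiation is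
  going to be iterated: it lowers exponents, and distinct monomials may then collide.\<close>

lemma partial_deriv_sum:
  assumes "finite A"
  shows "partial_deriv i (\<lambda>x. \<Sum>s\<in>A. a s * shifted_monomial X (e s) x) =
    (\<lambda>x. \<Sum>s\<in>A. a s * real (e s i) * shifted_monomial X ((e s)(i := e s i - 1)) x)"
proof
  fix x
  let ?R = "\<lambda>s. \<Prod>j\<in>UNIV - {i}. (x $ j - X $ j) ^ e s j"
  have line: "shifted_monomial X (e s) (x + t *\<^sub>R axis i 1) = (x $ i + t - X $ i) ^ e s i * ?R s" for s t
  proof -
    have "(\<Prod>j\<in>UNIV - {i}. ((x + t *\<^sub>R axis i 1) $ j - X $ j) ^ e s j) = ?R s"
      by (rule prod.cong) (auto simp: axis_def)
    then show ?thesis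
      using shifted_monomial_upd[of X "e s" i "e s i" "x + t *\<^sub>R axis i 1"] by (simp add: axis_def)
  qed
  have "((\<lambda>t. \<Sum>s\<in>A. a s * ((x $ i + t - X $ i) ^ e s i * ?R s)) has_field_derivative
     (\<Sum>s\<in>A. a s * (real (e s i) * (x $ i - X $ i) ^ (e s i - 1) * ?R s))) (at 0)"
    by (rule DERIV_sum) (auto intro!: derivative_eq_intros)
  then show "partial_deriv i (\<lambda>x. \<Sum>s\<in>A. a s * shifted_monomial X (e s) x) x =
    (\<Sum>s\<in>A. a s * real (e s i) * shifted_monomial X ((e s)(i := e s i - 1)) x)"
    unfolding partial_deriv_def line shifted_monomial_upd
    by (simp add: DERIV_imp_deriv mult_ac)
qed

lemma partial_deriv_power_sum:
  assumes "finite A"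
  shows "(partial_deriv i ^^ k) (\<lambda>x. \<Sum>s\<in>A. a s * shifted_monomial X (e s) x) =
    (\<lambda>x. \<Sum>s\<in>A. a s * deriv_factor (e s i) k * shifted_monomial X ((e s)(i := e s i - k)) x)"
proof (induction k)
  case 0
  then show ?case by (simp add: deriv_factor_def)
next
  case (Suc k)
  have step:
    "a s * deriv_factor (e s i) k * real (((e s)(i := e s i - k)) i) =
      a s * deriv_factor (e s i) (Suc k)"
    "((e s)(i := e s i - k))(i := ((e s)(i := e s i - k)) i - 1) =
      (e s)(i := e s i - Suc k)" for s
    by (simp_all add: deriv_factor_def)
  show ?case
    unfolding funpow.simps comp_apply Suc.IH partial_deriv_sum[OF assms] step ..
qed

lemma foldr_partial_deriv_sum:
  assumes "finite A" "distinct is"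
  shows "foldr (\<lambda>i. partial_deriv i ^^ \<beta> i) is (\<lambda>x. \<Sum>s\<in>A. a s * shifted_monomial X (e s) x) =
    (\<lambda>x. \<Sum>s\<in>A. a s * (\<Prod>i\<in>set is. deriv_factor (e s i) (\<beta> i)) *
       shifted_monomial X (\<lambda>i. if i \<in> set is then e s i - \<beta> i else e s i) x)"
  using assms(2)
proof (induction "is")
  case Nil
  then show ?case by simp
next
  case (Cons i "is")
  let ?e = "\<lambda>s j. if j \<in> set is then e s j - \<beta> j else e s j"
  have step:
    "(?e s)(i := ?e s i - \<beta> i) =
      (\<lambda>j. if j \<in> set (i # is) then e s j - \<beta> j else e s j)"
    "a s * (\<Prod>i\<in>set is. deriv_factor (e s i) (\<beta> i)) * deriv_factor (?e s i) (\<beta> i) =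
      a s * (\<Prod>i\<in>set (i # is). deriv_factor (e s i) (\<beta> i))" for s
    using Cons.prems by (auto simp: mult_ac)
  have IH: "foldr (\<lambda>i. partial_deriv i ^^ \<beta> i) is (\<lambda>x. \<Sum>s\<in>A. a s * shifted_monomial X (e s) x) =
      (\<lambda>x. \<Sum>s\<in>A. a s * (\<Prod>i\<in>set is. deriv_factor (e s i) (\<beta> i)) * shifted_monomial X (?e s) x)"
    using Cons by simp
  show ?case
    unfolding foldr.simps comp_apply IH partial_deriv_power_sum[OF assms(1)] step ..
qed

text \<open>After differentiation, every monomial with an index other than \<open>\<beta>\<close> either has been annihilated
  or still contains a factor that vanishes at the centre.\<close>

lemma mixed_deriv_center:
  fixes X :: "real ^ 'n"
  assumes "finite A"
  shows "mixed_deriv \<beta> (\<lambda>x. \<Sum>\<alpha>\<in>A. a \<alpha> * shifted_monomial X \<alpha> x) X =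
    (if \<beta> \<in> A then a \<beta> * (\<Prod>i\<in>UNIV. deriv_factor (\<beta> i) (\<beta> i)) else 0)"
proof -
  have "(\<Prod>i\<in>UNIV. deriv_factor (\<alpha> i) (\<beta> i)) * shifted_monomial X (\<lambda>i. \<alpha> i - \<beta> i) X =
      (if \<alpha> = \<beta> then (\<Prod>i\<in>UNIV. deriv_factor (\<beta> i) (\<beta> i)) else 0)" for \<alpha>
  proof (cases "\<exists>i. \<alpha> i < \<beta> i")
    case True
    then have "(\<Prod>i\<in>UNIV. deriv_factor (\<alpha> i) (\<beta> i)) = 0"
      by (auto intro: deriv_factor_eq_0)
    with True show ?thesis by auto
  next
    case False
    then have "(\<lambda>i. \<alpha> i - \<beta> i) = (\<lambda>_. 0) \<longleftrightarrow> \<alpha> = \<beta>"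
      by (auto simp: fun_eq_iff not_less intro: antisym)
    then show ?thesis
      by (auto simp: shifted_monomial_center)
  qed
  then have *: "a \<alpha> * (\<Prod>i\<in>UNIV. deriv_factor (\<alpha> i) (\<beta> i)) * shifted_monomial X (\<lambda>i. \<alpha> i - \<beta> i) X =
      (if \<alpha> = \<beta> then a \<beta> * (\<Prod>i\<in>UNIV. deriv_factor (\<beta> i) (\<beta> i)) else 0)" for \<alpha>
    by (simp add: mult.assoc)
  show ?thesis
    using foldr_partial_deriv_sum[OF assms coord_list(1), of \<beta> a X "\<lambda>\<alpha>. \<alpha>"]
    by (simp add: mixed_deriv_def coord_list(2) * assms)
qed

lemma mixed_deriv_vanishing_space:
  assumes "f \<in> vanishing_space X r n" "mdeg \<beta> < r"
  shows "mixed_deriv \<beta> f X = 0"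
  using assms by (auto simp: vanishing_space_def mixed_deriv_center[OF finite_mdeg_range])

lemma taylor_coefficients:
  fixes X :: "real ^ 'n"
  assumes "f \<in> poly_space n"
  obtains a where
    "f = (\<lambda>x. \<Sum>\<alpha> | mdeg \<alpha> \<le> n. a \<alpha> * shifted_monomial X \<alpha> x)"
    "\<And>\<beta>. mdeg \<beta> \<le> n \<Longrightarrow> a \<beta> = 0 \<longleftrightarrow> mixed_deriv \<beta> f X = 0"
    "\<And>\<beta>. mdeg \<beta> > n \<Longrightarrow> mixed_deriv \<beta> f X = 0"
proof -
  obtain a where f: "f = (\<lambda>x. \<Sum>\<alpha> | mdeg \<alpha> \<le> n. a \<alpha> * shifted_monomial X \<alpha> x)"
    using assms unfolding poly_space_eq_vanishing_space[of n X] vanishing_space_def by auto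
  show thesis
    by (rule that[OF f]) (auto simp: f mixed_deriv_center[OF finite_mdeg_le] deriv_factor_self)
qed

section \<open>Restriction to a line\<close>

text \<open>The monomial with exponents \<open>\<alpha>\<close>, centred at \<open>X\<close>, takes the value
  \<open>(\<Prod>i. v\<^sub>i ^ \<alpha>\<^sub>i) * t ^ mdeg \<alpha>\<close> at \<open>X + t v\<close>. Hence a polynomial with Taylor coefficients
  \<open>a\<close> at \<open>X\<close> restricts to the following univariate polynomial, in which neither \<open>X\<close> nor the
  individual points of the line occur.\<close>

definition line_poly :: "real ^ 'n \<Rightarrow> nat \<Rightarrow> (('n \<Rightarrow> nat) \<Rightarrow> real) \<Rightarrow> real poly"
  where "line_poly v n a =
    (\<Sum>\<alpha> | mdeg \<alpha> \<le> n. monom (a \<alpha> * (\<Prod>i\<in>UNIV. (v $ i) ^ \<alpha> i)) (mdeg \<alpha>))"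

lemma poly_line_poly:
  "poly (line_poly v n a) t = (\<Sum>\<alpha> | mdeg \<alpha> \<le> n. a \<alpha> * shifted_monomial X \<alpha> (X + t *\<^sub>R v))"
  by (simp add: line_poly_def poly_sum poly_monom shifted_monomial_line mult_ac)

lemma degree_line_poly: "degree (line_poly v n a) \<le> n"
  unfolding line_poly_def
  by (rule degree_sum_le[OF finite_mdeg_le]) (auto intro: order_trans[OF degree_monom_le])

lemma coeff_line_poly:
  "coeff (line_poly v n a) k =
    (\<Sum>\<alpha> | mdeg \<alpha> \<le> n \<and> mdeg \<alpha> = k. a \<alpha> * (\<Prod>i\<in>UNIV. (v $ i) ^ \<alpha> i))"
proof -
  have "{\<alpha> :: 'a \<Rightarrow> nat. mdeg \<alpha> \<le> n} \<inter> {\<alpha>. mdeg \<alpha> = k} = {\<alpha>. mdeg \<alpha> \<le> n \<and> mdeg \<alpha> = k}"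
    by auto
  then show ?thesis
    by (simp add: line_poly_def coeff_sum sum.If_cases finite_mdeg_le cong: if_cong)
qed

text \<open>Zeros of \<open>g\<close> at \<open>0\<close> and at \<open>1\<close> both count towards its degree. The zero at \<open>1\<close> is expressed by the
  translate \<open>h\<close>, because the Taylor expansion at a second node on the line yields the
  restriction with the parameter shifted by one.\<close>

lemma root_multiplicities_le_degree:
  fixes g h :: "real poly"
  assumes "h \<noteq> 0" "monom 1 a dvd g" "monom 1 b dvd h" "\<And>t. poly h t = poly g (1 + t)"
  shows "a + b \<le> degree g"
proof -
  obtain u where u: "h = monom 1 b * u"
    using assms(3) by (rule dvdE)
  define q where "q = pcompose u [:-1, 1:]"
  have g: "g = [:-1, 1:] ^ b * q"
  proof (rule poly_ext)
    fix t
    show "poly g t = poly ([:-1, 1:] ^ b * q) t"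
      using assms(4)[of "t - 1"] by (simp add: u q_def poly_pcompose poly_monom algebra_simps)
  qed
  have "g \<noteq> 0"
  proof
    assume "g = 0"
    then have "h = 0"
      using assms(4) by (simp add: poly_ext)
    with assms(1) show False by simp
  qed
  then have q: "q \<noteq> 0"
    by (auto simp: g)
  have "a \<le> order 0 g"
    using assms(2) \<open>g \<noteq> 0\<close> by (simp add: monom_1_dvd_iff)
  also have "\<dots> = order 0 q"
    using \<open>g \<noteq> 0\<close> unfolding g by (simp add: order_mult order_0I)
  also have "\<dots> \<le> degree q"
    by (rule order_degree[OF q])
  finally show ?thesis
    using q by (simp add: g degree_mult_eq degree_power_eq)
qed

text \<open>Prescribe zero data except for one derivative of the top order \<open>p r\<close> at \<open>X r\<close>, taken in a coordinate
  direction that is not orthogonal to the line. The restriction of a solution to the line is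
  nonzero by this choice, has a zero of multiplicity more than \<open>p q\<close> at \<open>X q\<close> and a zero of
  multiplicity at least \<open>p r\<close> at \<open>X r\<close>, so that its degree is at least \<open>p q + 1 + p r\<close>.\<close>

lemma regular_pair_bound:
  fixes X :: "nat \<Rightarrow> real ^ 'n"
  assumes reg: "hermite_regular n m p X" and inj: "inj_on X {1..m}"
    and qr: "q \<in> {1..m}" "r \<in> {1..m}" "q \<noteq> r"
  shows "p q + p r + 1 \<le> n"
proof -
  define v where "v = X r - X q"
  have "v \<noteq> 0"
    using inj_onD[OF inj, of r q] qr by (auto simp: v_def)
  then obtain i where i: "v $ i \<noteq> 0"
    by (auto simp: vec_eq_iff)
  define \<beta> where "\<beta> = (\<lambda>j. if j = i then p r else 0)"
  have mdeg_\<beta>: "mdeg \<beta> = p r"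
    by (simp add: \<beta>_def mdeg_def)
  obtain f where f: "hermite_solution n m p X (\<lambda>s \<alpha>. of_bool (s = r \<and> \<alpha> = \<beta>)) f"
    using reg unfolding hermite_regular_def by blast
  then have poly: "f \<in> poly_space n"
    by (simp add: hermite_solution_def)
  have data_q: "mixed_deriv \<alpha> f (X q) = 0" if "mdeg \<alpha> \<le> p q" for \<alpha>
    using f that qr by (simp add: hermite_solution_def)
  have data_r: "mixed_deriv \<alpha> f (X r) = of_bool (\<alpha> = \<beta>)" if "mdeg \<alpha> \<le> p r" for \<alpha>
    using f that qr by (simp add: hermite_solution_def)
  obtain a where a: "f = (\<lambda>x. \<Sum>\<alpha> | mdeg \<alpha> \<le> n. a \<alpha> * shifted_monomial (X q) \<alpha> x)"
    "\<And>\<alpha>. mdeg \<alpha> \<le> n \<Longrightarrow> a \<alpha> = 0 \<longleftrightarrow> mixed_deriv \<alpha> f (X q) = 0"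
    by (rule taylor_coefficients[OF poly, of "X q"]) blast
  obtain b where b: "f = (\<lambda>x. \<Sum>\<alpha> | mdeg \<alpha> \<le> n. b \<alpha> * shifted_monomial (X r) \<alpha> x)"
    "\<And>\<alpha>. mdeg \<alpha> \<le> n \<Longrightarrow> b \<alpha> = 0 \<longleftrightarrow> mixed_deriv \<alpha> f (X r) = 0"
    "\<And>\<alpha>. mdeg \<alpha> > n \<Longrightarrow> mixed_deriv \<alpha> f (X r) = 0"
    by (rule taylor_coefficients[OF poly, of "X r"]) blast
  define g where "g = line_poly v n"
  have "p r \<le> n"
    using b(3)[of \<beta>] data_r[of \<beta>] mdeg_\<beta> by (cases "p r \<le> n") auto
  have a0: "coeff (g a) k = 0" if "k < Suc (p q)" for k
    unfolding g_def coeff_line_poly using that by (intro sum.neutral) (auto simp: a(2) data_q)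
  have b0: "coeff (g b) k = 0" if "k < p r" for k
    unfolding g_def coeff_line_poly using that mdeg_\<beta> by (intro sum.neutral) (auto simp: b(2) data_r)
  \<comment> \<open>Only \<open>\<beta>\<close> contributes in order \<open>p r\<close>, and \<open>v $ i\<close> is nonzero: the restriction does not vanish.\<close>
  have "coeff (g b) (p r) = (\<Sum>\<alpha>\<in>{\<beta>}. b \<alpha> * (\<Prod>i\<in>UNIV. (v $ i) ^ \<alpha> i))"
    unfolding g_def coeff_line_poly using \<open>p r \<le> n\<close> mdeg_\<beta>
    by (intro sum.mono_neutral_right) (auto simp: b(2) data_r finite_mdeg_le)
  also have "\<dots> = b \<beta> * (v $ i) ^ p r"
    by (simp add: \<beta>_def if_distrib[of "\<lambda>k. _ ^ k"] cong: if_cong)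
  also have "\<dots> \<noteq> 0"
    using i b(2)[of \<beta>] data_r[of \<beta>] mdeg_\<beta> \<open>p r \<le> n\<close> by simp
  finally have "g b \<noteq> 0"
    by auto
  have "poly (g b) t = poly (g a) (1 + t)" for t
  proof -
    have "poly (g b) t = f (X r + t *\<^sub>R v)"
      using poly_line_poly[of v n b t "X r"] fun_cong[OF b(1), of "X r + t *\<^sub>R v"] by (simp add: g_def)
    also have "X r + t *\<^sub>R v = X q + (1 + t) *\<^sub>R v"
      by (simp add: v_def algebra_simps)
    also have "f \<dots> = poly (g a) (1 + t)"
      using poly_line_poly[of v n a "1 + t" "X q"] fun_cong[OF a(1), of "X q + (1 + t) *\<^sub>R v"]
      by (simp add: g_def)
    finally show ?thesis .
  qed
  then have "Suc (p q) + p r \<le> degree (g a)"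
    using \<open>g b \<noteq> 0\<close> a0 b0
    by (intro root_multiplicities_le_degree[of "g b"]) (auto simp: monom_1_dvd_iff')
  then show ?thesis
    using degree_line_poly[of v n a] by (simp add: g_def)
qed

section \<open>Products of hyperplanes\<close>

text \<open>Lay the nodes out as consecutive blocks of cells \<open>0, 1, 2, \<dots>\<close>, the block of \<open>q\<close> having length
  \<open>a q\<close>, and let cell \<open>c\<close> put its node into the set number \<open>c mod n\<close>. A block of length at most
  \<open>n\<close> meets each residue class at most once, so \<open>q\<close> gets into \<open>a q\<close> different sets; and as there
  are at most \<open>n * d\<close> cells, each residue class has at most \<open>d\<close> of them.\<close>

lemma cyclic_cover:
  fixes a :: "nat \<Rightarrow> nat"
  assumes a: "\<And>q. q \<in> {1..m} \<Longrightarrow> a q \<le> n" and total: "(\<Sum>q=1..m. a q) \<le> n * d"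
  obtains S :: "nat \<Rightarrow> nat set" where
    "\<And>j. S j \<subseteq> {1..m}" "\<And>j. card (S j) \<le> d"
    "\<And>q. q \<in> {1..m} \<Longrightarrow> a q \<le> card {j. j < n \<and> q \<in> S j}"
proof -
  define s where "s q = (\<Sum>i=1..<q. a i)" for q
  have s_Suc: "s (Suc q) = s q + a q" if "q \<ge> 1" for q
    using that by (simp add: s_def)
  have s_mono: "s q \<le> s r" if "q \<le> r" for q r
    unfolding s_def using that by (intro sum_mono2) auto
  have s_end: "s q + a q \<le> n * d" if "q \<in> {1..m}" for q
  proof -
    have "s q + a q \<le> s (Suc m)"
      using that s_mono[of "Suc q" "Suc m"] by (simp add: s_Suc)
    also have "\<dots> \<le> n * d"
      using total by (simp add: s_def atLeastLessThanSuc_atLeastAtMost)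
    finally show ?thesis .
  qed
  have block: "q = r"
    if "q \<in> {1..m}" "r \<in> {1..m}" "s q \<le> c" "c < s q + a q" "s r \<le> c" "c < s r + a r" for q r c
  proof (rule ccontr)
    assume "q \<noteq> r"
    then consider "Suc q \<le> r" | "Suc r \<le> q" by linarith
    then show False
      using s_mono[of "Suc q" r] s_mono[of "Suc r" q] that by cases (auto simp: s_Suc)
  qed
  define S where "S j = {q \<in> {1..m}. \<exists>c. s q \<le> c \<and> c < s q + a q \<and> c mod n = j}" for j
  show thesis
  proof (rule that[of S])
    show "S j \<subseteq> {1..m}" for j
      by (auto simp: S_def)
    show "card (S j) \<le> d" for j
    proof -
      have "\<forall>q\<in>S j. \<exists>c. s q \<le> c \<and> c < s q + a q \<and> c mod n = j"
        by (simp add: S_def)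
      then obtain c where c: "\<And>q. q \<in> S j \<Longrightarrow> s q \<le> c q \<and> c q < s q + a q \<and> c q mod n = j"
        by metis
      have "c q div n < d" if "q \<in> S j" for q
        using c[OF that] s_end[of q] that
        by (intro less_mult_imp_div_less) (auto simp: S_def mult.commute)
      moreover have "inj_on (\<lambda>q. c q div n) (S j)"
      proof (rule inj_onI)
        fix q r
        assume qr: "q \<in> S j" "r \<in> S j" "c q div n = c r div n"
        then have "c q = c r"
          using c by (metis mult_div_mod_eq)
        with qr c[of q] c[of r] show "q = r"
          by (intro block[of q r "c q"]) (auto simp: S_def)
      qed
      ultimately show ?thesis
        using card_inj_on_le[of "\<lambda>q. c q div n" "S j" "{..<d}"] by auto
    qed
    show "a q \<le> card {j. j < n \<and> q \<in> S j}" if q: "q \<in> {1..m}" for q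
    proof -
      have "inj_on (\<lambda>c. c mod n) {s q..<s q + a q}"
      proof (rule linorder_inj_onI)
        fix x y
        assume xy: "x < y" "x \<in> {s q..<s q + a q}" "y \<in> {s q..<s q + a q}"
        show "x mod n \<noteq> y mod n"
        proof
          assume "x mod n = y mod n"
          then have "n dvd y - x"
            using xy mod_eq_dvd_iff_nat[of x y n] by simp
          then have "n \<le> y - x"
            using xy by (auto dest: dvd_imp_le)
          with xy a[OF q] show False by auto
        qed
      qed auto
      moreover have "(\<lambda>c. c mod n) ` {s q..<s q + a q} \<subseteq> {j. j < n \<and> q \<in> S j}"
        using q a[OF q] by (auto simp: S_def intro!: mod_less_divisor)
      ultimately show ?thesis
        using card_inj_on_le[of "\<lambda>c. c mod n" "{s q..<s q + a q}" "{j. j < n \<and> q \<in> S j}"] by simp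
    qed
  qed
qed

lemma few_points_on_hyperplane:
  fixes P :: "(real ^ 'n) set"
  assumes "finite P" "card P \<le> CARD('n)"
  obtains w b where "w \<noteq> 0" "\<And>x. x \<in> P \<Longrightarrow> w \<bullet> x = b"
proof -
  have "aff_dim P \<le> int (card P) - 1"
    by (rule aff_dim_le_card[OF assms(1)])
  then have "aff_dim P < DIM(real ^ 'n)"
    using assms(2) by simp
  then show thesis
    using aff_lowdim_subset_hyperplane that by (metis (mono_tags, lifting) mem_Collect_eq subsetD)
qed

lemma prod_affine_in_vanishing_space:
  fixes w :: "nat \<Rightarrow> real ^ 'n"
  shows "(\<lambda>x. \<Prod>j<n. (w j \<bullet> x - b j)) \<in> vanishing_space X (card {j. j < n \<and> w j \<bullet> X = b j}) n"
proof (induction n)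
  case 0
  have "shifted_monomial X (\<lambda>_. 0) = (\<lambda>x. 1)"
    by (simp add: shifted_monomial_def fun_eq_iff)
  then show ?case
    using shifted_monomial_in_vanishing_space[of 0 "\<lambda>_. 0" 0 X] by (simp add: mdeg_def)
next
  case (Suc n)
  show ?case
  proof (cases "w n \<bullet> X = b n")
    case True
    then have "{j. j < Suc n \<and> w j \<bullet> X = b j} = insert n {j. j < n \<and> w j \<bullet> X = b j}"
      by (auto simp: less_Suc_eq)
    then show ?thesis
      using vanishing_space_mult_affine_through[OF Suc.IH True] by (simp add: mult.commute)
  next
    case False
    then have "{j. j < Suc n \<and> w j \<bullet> X = b j} = {j. j < n \<and> w j \<bullet> X = b j}"
      by (auto simp: less_Suc_eq)
    then show ?thesis
      using vanishing_space_mult_affine[OF Suc.IH, of "w n" "b n"] by (simp add: mult.commute)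
  qed
qed

text \<open>Finitely many hyperplanes do not cover the space, since each of them has measure zero.\<close>

lemma prod_affine_nonzero:
  fixes w :: "nat \<Rightarrow> real ^ 'n"
  assumes "\<And>j. w j \<noteq> 0"
  obtains x where "(\<Prod>j<n. (w j \<bullet> x - b j)) \<noteq> 0"
proof -
  have "negligible (\<Union>j<n. {x. w j \<bullet> x = b j})"
    using assms by (intro negligible_Union) (auto intro: negligible_hyperplane)
  then have "(\<Union>j<n. {x. w j \<bullet> x = b j}) \<noteq> UNIV"
    using non_negligible_UNIV by metis
  then show thesis
    using that by (auto simp: prod_zero_iff)
qed

text \<open>Otherwise the nodes can be distributed over \<open>n\<close> hyperplanes, with at most \<open>CARD('n)\<close> nodes
  assigned to each of them, such that every node \<open>X q\<close> lies on at least \<open>p q + 1\<close> of them. The product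
  of their equations is then a second solution for zero data, besides \<open>0\<close>.\<close>

lemma regular_total_bound:
  fixes X :: "nat \<Rightarrow> real ^ 'n"
  assumes reg: "hermite_regular n m p X" and p: "\<And>q. q \<in> {1..m} \<Longrightarrow> p q < n"
  shows "n * CARD('n) < (\<Sum>q=1..m. Suc (p q))"
proof (rule ccontr)
  assume "\<not> ?thesis"
  then obtain S where S: "\<And>j. S j \<subseteq> {1..m}" "\<And>j. card (S j) \<le> CARD('n)"
    "\<And>q. q \<in> {1..m} \<Longrightarrow> Suc (p q) \<le> card {j. j < n \<and> q \<in> S j}"
    using cyclic_cover[of m "\<lambda>q. Suc (p q)" n "CARD('n)"] p by (auto simp: Suc_le_eq)
  have "\<exists>w b. w \<noteq> 0 \<and> (\<forall>q\<in>S j. w \<bullet> X q = b)" for j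
  proof -
    have fin: "finite (S j)"
      using S(1) finite_subset by blast
    then have "card (X ` S j) \<le> CARD('n)"
      using card_image_le[of "S j" X] S(2)[of j] by linarith
    then show ?thesis
      using few_points_on_hyperplane[of "X ` S j"] fin by (metis finite_imageI imageI)
  qed
  then obtain w b where wb: "\<And>j. w j \<noteq> 0" "\<And>j q. q \<in> S j \<Longrightarrow> w j \<bullet> X q = b j"
    by metis
  define f where "f = (\<lambda>x. \<Prod>j<n. (w j \<bullet> x - b j))"
  have deriv: "mixed_deriv \<alpha> f (X q) = 0" if "q \<in> {1..m}" "mdeg \<alpha> \<le> p q" for q \<alpha>
  proof -
    have "card {j. j < n \<and> q \<in> S j} \<le> card {j. j < n \<and> w j \<bullet> X q = b j}"
      by (rule card_mono) (auto simp: wb(2))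
    then have "mdeg \<alpha> < card {j. j < n \<and> w j \<bullet> X q = b j}"
      using S(3)[OF that(1)] that(2) by linarith
    then show ?thesis
      unfolding f_def by (rule mixed_deriv_vanishing_space[OF prod_affine_in_vanishing_space])
  qed
  have "f \<in> vanishing_space 0 0 n"
    unfolding f_def using vanishing_space_mono[OF prod_affine_in_vanishing_space] by blast
  then have "f \<in> poly_space n"
    using poly_space_eq_vanishing_space by blast
  then have "hermite_solution n m p X (\<lambda>_ _. 0) f"
    by (simp add: hermite_solution_def deriv)
  moreover have "hermite_solution n m p X (\<lambda>_ _. 0) (\<lambda>_. 0)"
  proof -
    have "(\<lambda>_. 0) \<in> vanishing_space (X q) (Suc (p q)) n" for q
      by (rule vanishing_space_zero)
    moreover have "(\<lambda>_ :: real ^ 'n. 0) \<in> poly_space n"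
      unfolding poly_space_eq_vanishing_space[of n 0] by (rule vanishing_space_zero)
    ultimately show ?thesis
      unfolding hermite_solution_def using mixed_deriv_vanishing_space le_imp_less_Suc by metis
  qed
  ultimately have "f = (\<lambda>_. 0)"
    using reg unfolding hermite_regular_def by blast
  moreover obtain x where "f x \<noteq> 0"
    unfolding f_def using prod_affine_nonzero[where w = w and n = n and b = b] wb(1) by blast
  ultimately show False
    by simp
qed

section \<open>Singularity\<close>

text \<open>Here \<open>a q\<close> stands for \<open>p q + 1\<close>. All numbers but the last are at most \<open>a (m - 1)\<close>, which is at
  most half of \<open>n + 1\<close>. For \<open>n \<ge> 3\<close> the claim follows from \<open>3 * (n + 1) \<le> 4 * n\<close>. For \<open>n = 2\<close>
  rounding helps: half of \<open>n + 1\<close> can be replaced by \<open>1\<close>.\<close>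

lemma incompatible_bounds:
  fixes a :: "nat \<Rightarrow> nat"
  assumes "d \<ge> 1" "m \<ge> 2" "2 * m \<le> 3 * d" "n \<ge> 2"
    and mono: "\<And>i. 1 \<le> i \<Longrightarrow> i < m \<Longrightarrow> a i \<le> a (m - 1)"
    and le: "a (m - 1) \<le> a m"
    and pair: "a (m - 1) + a m \<le> n + 1"
  shows "(\<Sum>q=1..m. a q) \<le> n * d"
proof -
  obtain l where l: "m = Suc (Suc l)"
    using \<open>m \<ge> 2\<close> by (metis Suc_le_D numeral_2_eq_2 Suc_le_mono)
  have "(\<Sum>q=1..m. a q) = (\<Sum>q=1..l. a q) + (a (m - 1) + a m)"
    by (simp add: l)
  also have "(\<Sum>q=1..l. a q) \<le> l * a (m - 1)"
    using sum_bounded_above[of "{1..l}" a "a (m - 1)"] mono l by simp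
  finally have sum: "(\<Sum>q=1..m. a q) \<le> l * a (m - 1) + (a (m - 1) + a m)"
    by simp
  show ?thesis
  proof (cases "n = 2")
    case True
    then have "a (m - 1) \<le> 1"
      using le pair by simp
    then have "l * a (m - 1) \<le> l"
      by simp
    then have "(\<Sum>q=1..m. a q) \<le> l + 3"
      using sum pair True by linarith
    moreover have "l + 3 \<le> 2 * d"
      using assms(2,3) l by presburger
    ultimately show ?thesis
      using True by simp
  next
    case False
    have "2 * (l * a (m - 1)) = l * (2 * a (m - 1))"
      by simp
    also have "\<dots> \<le> l * (n + 1)"
      using le pair by (intro mult_le_mono2) simp
    finally have "4 * (\<Sum>q=1..m. a q) \<le> 2 * m * (n + 1)"
      using sum pair by (simp add: l algebra_simps)
    also have "\<dots> \<le> 3 * d * (n + 1)"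
      using assms(3) by (rule mult_le_mono1)
    also have "\<dots> \<le> d * (4 * n)"
      using False \<open>n \<ge> 2\<close> by (simp add: algebra_simps flip: mult.assoc)
    finally show ?thesis
      by (simp add: mult.commute)
  qed
qed

theorem corollary4:
  fixes d m n :: nat and k :: int and p :: "nat \<Rightarrow> nat"
  assumes "CARD('n::finite) = d"
    and "d \<ge> 2" and "m \<ge> 2"
    and "int d \<ge> 2 * k" and "int m \<le> int d + k"
    and "\<And>i j. 1 \<le> i \<Longrightarrow> i \<le> j \<Longrightarrow> j \<le> m \<Longrightarrow> p i \<le> p j"
    and "(n + d) choose d = (\<Sum>q = 1..m. (p q + d) choose d)"
    and "\<not> (\<forall>q\<in>{1..m}. p q = 0)"
  shows "scheme_singular TYPE('n) n m p"
  unfolding scheme_singular_def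
proof (intro allI impI notI)
  fix X :: "nat \<Rightarrow> real ^ 'n"
  assume inj: "inj_on X {1..m}" and reg: "hermite_regular n m p X"
  have pair: "p (m - 1) + p m + 1 \<le> n"
    by (rule regular_pair_bound[OF reg inj]) (use \<open>m \<ge> 2\<close> in auto)
  have max: "p q \<le> p m" if "q \<in> {1..m}" for q
    using assms(6) that by auto
  have "p m \<ge> 1"
    using assms(8) max by (metis le_zero_eq less_one not_le)
  then have "n \<ge> 2"
    using pair by simp
  have "n * d < (\<Sum>q=1..m. Suc (p q))"
    using regular_total_bound[OF reg] max pair assms(1) by fastforce
  moreover have "(\<Sum>q=1..m. Suc (p q)) \<le> n * d"
    using assms(2-5) \<open>n \<ge> 2\<close> pair by (intro incompatible_bounds) (auto intro!: assms(6))
  ultimately show False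
    by simp
qed

end
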